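(* Let $\mathbb{K}\in\{\mathbb{R},\mathbb{C}\}$, let $L$ be a compact Hausdorff space, let $\rho\subseteq L\times L$ be a closed equivalence relation on $L$, let $L':=\{x\in L:|[x]|>1\}$, and let $R$ be a set of representatives of $\rho$ such that $\xi_R\circ\pi|_{\overline{L'}}$ is continuous. Put $R':=\overline{L'}\cap R$ and $\kappa_0:=\dim\big(\mathrm{Ker}(\mathrm{res}_{\overline{R'}}^{\overline{L'}})\big)$. Then $\mathcal{C}(L,\mathbb{K})\setminus\mathcal{C}_\rho(L,\mathbb{K})$ is $\kappa_0$-lineable but not $\kappa_0^{+}$-lineable.
   Context: For a compact Hausdorff space $X$, $\mathcal{C}(X,\mathbb{K})$ is the Banach space of continuous functions $X\to\mathbb{K}$ with the sup-norm; for a closed subset $Y\subseteq X$, $\mathrm{res}_Y^X:\mathcal{C}(X,\mathbb{K})\to\mathcal{C}(Y,\mathbb{K})$ is the restriction map $f\mapsto f|_Y$. $[x]$ denotes the $\rho$-equivalence class of $x$, $\pi:L\to L/\rho$ is the quotient map, and $\mathcal{C}_\rho(L,\mathbb{K}):=\{f\in\mathcal{C}(L,\mathbb{K}): x\,\rho\, y\Rightarrow f(x)=f(y)\}$. A set of representatives of $\rho$ is a subset $R\subseteq L$ containing exactly one element of each equivalence class; its associated map $\xi_R:L/\rho\to L$ sends each class to its unique element in $R$ (so $\xi_R[L/\rho]=R$ and $\pi\circ\xi_R=\mathrm{id}_{L/\rho}$). Overlines on subsets of $L$ denote closure in $L$. Dimensions are algebraic dimensions over $\mathbb{K}$, and $\kappa^{+}$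 is the least cardinal greater than $\kappa$. A subset $M$ of a vector space $V$ is $\kappa$-lineable if $M\cup\{0\}$ contains a vector subspace of $V$ of dimension $\kappa$. *)

theory Defs
  imports "HOL-Analysis.Analysis" "HOL-Library.Function_Algebras"
begin

unbundle cardinal_syntax

definition pscale :: "'k::field \<Rightarrow> ('a \<Rightarrow> 'k) \<Rightarrow> 'a \<Rightarrow> 'k"
  where "pscale c f = (\<lambda>x. c * f x)"

global_interpretation fun_space: vector_space "pscale :: 'k::field \<Rightarrow> ('a \<Rightarrow> 'k) \<Rightarrow> 'a \<Rightarrow> 'k"
  by unfold_locales (auto simp: pscale_def fun_eq_iff algebra_simps)

text \<open>Algebraic dimension as a cardinal. The library's \<open>dim\<close> is a natural number and is \<open>0\<close> on
  infinite-dimensional spaces, so the cardinality of a (Hamel) basis is taken instead.\<close>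

definition alg_dim :: "('k::field \<Rightarrow> 'v \<Rightarrow> 'v::ab_group_add) \<Rightarrow> 'v set \<Rightarrow> 'v rel"
  where "alg_dim smul V =
    |SOME B. \<not> module.dependent smul B \<and> module.span smul B = V|"

definition lineable :: "('k::field \<Rightarrow> 'v \<Rightarrow> 'v::ab_group_add) \<Rightarrow> 'c rel \<Rightarrow> 'v set \<Rightarrow> bool"
  where "lineable smul \<kappa> M \<longleftrightarrow>
    (\<exists>W. module.subspace smul W \<and> W \<subseteq> M \<union> {0} \<and> alg_dim smul W =o \<kappa>)"

text \<open>Continuous functions on \<open>X\<close> are represented by total functions that are \<open>0\<close> outside
  \<open>topspace X\<close>; this makes the representation unique and the set a linear subspace of the
  function type. Elements of \<open>C(Y)\<close> for a subspace \<open>Y\<close> are likewise \<open>0\<close> outside \<open>Y\<close>, so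
  \<open>res\<close> cuts off at \<open>Y\<close>.\<close>

definition cont_fun :: "'a topology \<Rightarrow> ('a \<Rightarrow> 'k::real_normed_field) set"
  where "cont_fun X = {f. continuous_map X euclidean f \<and> (\<forall>x. x \<notin> topspace X \<longrightarrow> f x = 0)}"

definition cont_fun_rel :: "'a topology \<Rightarrow> 'a rel \<Rightarrow> ('a \<Rightarrow> 'k::real_normed_field) set"
  where "cont_fun_rel X \<rho> = {f \<in> cont_fun X. \<forall>x y. (x, y) \<in> \<rho> \<longrightarrow> f x = f y}"

definition res :: "'a set \<Rightarrow> ('a \<Rightarrow> 'k::zero) \<Rightarrow> 'a \<Rightarrow> 'k"
  where "res Y f = (\<lambda>x. if x \<in> Y then f x else 0)"

definition res_ker :: "'a topology \<Rightarrow> 'a set \<Rightarrow> 'a set \<Rightarrow> ('a \<Rightarrow> 'k::real_normed_field) set"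
  where "res_ker L X Y = {f \<in> cont_fun (subtopology L X). res Y f = 0}"

definition quot_map :: "'a rel \<Rightarrow> 'a \<Rightarrow> 'a set"
  where "quot_map \<rho> x = \<rho> `` {x}"

definition representatives :: "'a set \<Rightarrow> 'a rel \<Rightarrow> 'a set \<Rightarrow> bool"
  where "representatives S \<rho> R \<longleftrightarrow> R \<subseteq> S \<and> (\<forall>c \<in> S // \<rho>. \<exists>!x. x \<in> c \<inter> R)"

definition rep_map :: "'a set \<Rightarrow> 'a set \<Rightarrow> 'a"
  where "rep_map R c = (THE x. x \<in> c \<inter> R)"

end

theory Submission
  imports Defs
begin

text \<open>
  Write \<open>X\<close> for the closure of \<open>L'\<close>, \<open>r\<close> for the retraction \<open>\<xi>\<^sub>R \<circ> \<pi>\<close> on \<open>X\<close>, and \<open>K\<close> for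
  the kernel of the restriction from \<open>X\<close> to the closure of \<open>R'\<close>. Two linear maps compare \<open>K\<close> with
  subspaces of \<open>C(L)\<close> that meet \<open>C\<^sub>\<rho>(L)\<close> only in \<open>0\<close>.

  The map \<open>f \<mapsto> f|X - (f \<circ> r)|X\<close> sends \<open>C(L)\<close> into \<open>K\<close>, because \<open>r\<close> fixes \<open>R'\<close> pointwise. If it
  kills \<open>f\<close>, then \<open>f\<close> takes at each point of a non-trivial class the value at the representative,
  so \<open>f \<in> C\<^sub>\<rho>(L)\<close>. A subspace that avoids \<open>C\<^sub>\<rho>(L)\<close> therefore embeds into \<open>K\<close>, and its dimension is
  at most \<open>\<kappa>\<^sub>0\<close> (\<open>not_lineable_cardSuc\<close>, \<open>not_lineable_cont_fun_diff\<close>).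

  Conversely, by Tietze's theorem every element of a Hamel basis of \<open>K\<close> extends to a continuous
  function on \<open>L\<close>. The extensions span a space that restriction to \<open>X\<close> maps isomorphically onto
  \<open>K\<close>. If \<open>f\<close> in this space is constant on classes, then on \<open>L'\<close> it agrees with its values on
  \<open>R'\<close>, where it vanishes; by density \<open>f|X = 0\<close>, hence \<open>f = 0\<close> (\<open>lineable_if_image_covers\<close>,
  \<open>lineable_cont_fun_diff\<close>).

  Both arguments are the same for real and complex scalars; only the extension theorem is proved
  separately, with the complex case reduced to real and imaginary parts.
\<close>

section \<open>Lineability of the complement through linear maps\<close>

text \<open>Any two bases of a space are equipotent, so the arbitrary choice in \<^const>\<open>alg_dim\<close> is
  harmless.\<close>

lemma (in vector_space) alg_dim_eq_card_basis:
  assumes "independent B" and "span B = V"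
  shows "alg_dim scale V =o |B|"
proof -
  let ?P = "\<lambda>B. independent B \<and> span B = V"
  have "?P (SOME B. ?P B)"
    using assms by (rule_tac someI[of ?P]) auto
  then show ?thesis
    using bij_if_span_eq_span_bases[of "SOME B. ?P B" B] assms
    by (auto simp: alg_dim_def card_of_ordIso)
qed

lemma (in vector_space) subspace_has_basis:
  assumes "subspace V"
  obtains B where "independent B" and "span B = V"
  using maximal_independent_subset[of V] span_minimal[OF _ assms] by (metis subset_antisym)

context vector_space_pair
begin

text \<open>The space is spanned by preimages under \<open>P\<close> of a basis of \<open>K\<close>; choosing preimages only on a
  basis makes \<open>P\<close> injective on their span.\<close>

lemma lineable_if_image_covers:
  assumes P: "Vector_Spaces.linear s1 s2 P"
    and V: "vs1.subspace V" and K: "vs2.subspace K"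
    and cover: "K \<subseteq> P ` V"
    and zero: "\<And>f. f \<in> V \<Longrightarrow> f \<in> M \<Longrightarrow> P f \<in> K \<Longrightarrow> P f = 0"
  shows "lineable s1 (alg_dim s2 K) (V - M)"
proof -
  interpret P: Vector_Spaces.linear s1 s2 P by fact
  obtain B where B: "vs2.independent B" "vs2.span B = K"
    using vs2.subspace_has_basis[OF K] .
  have "B \<subseteq> P ` V"
    using subset_trans[OF vs2.span_superset[of B, unfolded B(2)] cover] .
  then obtain C where C: "C \<subseteq> V" "inj_on P C" "P ` C = B"
    unfolding subset_image_inj by blast
  have inj: "inj_on P (vs1.span C)"
    using P.inj_on_span_independent_image[of C] C B by simp
  have ind: "vs1.independent C"
    unfolding vs1.dependent_def
  proof clarify
    fix c assume c: "c \<in> C" "c \<in> vs1.span (C - {c})"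
    have "P c \<in> vs2.span (P ` (C - {c}))"
      using c(2) P.span_image by blast
    moreover have "P ` (C - {c}) = B - {P c}"
      using C(2,3) c(1) by (auto dest: inj_onD)
    ultimately show False
      using B(1) C(3) c(1) by (auto simp: vs2.dependent_def)
  qed
  have sub: "vs1.span C \<subseteq> V"
    using C(1) V by (rule vs1.span_minimal)
  have "f = 0" if f: "f \<in> vs1.span C" "f \<in> M" for f
  proof -
    have "P f \<in> K"
      using f(1) P.span_image[of C] C(3) B(2) by auto
    then have "P f = P 0"
      using zero f sub P.zero by auto
    then show "f = 0"
      using f(1) vs1.span_zero by (rule inj_onD[OF inj])
  qed
  moreover have "alg_dim s1 (vs1.span C) =o alg_dim s2 K"
  proof -
    have "|C| =o |B|"
      using C(2,3) by (intro card_of_ordIsoI) (rule bij_betw_imageI)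
    then show ?thesis
      using vs1.alg_dim_eq_card_basis[OF ind refl] vs2.alg_dim_eq_card_basis[OF B]
      by (meson ordIso_transitive ordIso_symmetric)
  qed
  ultimately show ?thesis
    unfolding lineable_def using sub by (intro exI[of _ "vs1.span C"]) auto
qed

text \<open>A subspace of \<open>V\<close> that avoids \<open>M\<close> meets the kernel of \<open>D\<close> trivially, so \<open>D\<close> carries a basis
  of it to an independent subset of \<open>K\<close>.\<close>

lemma not_lineable_cardSuc:
  assumes D: "Vector_Spaces.linear s1 s2 D"
    and K: "vs2.subspace K"
    and into: "D ` V \<subseteq> K"
    and ker: "\<And>f. f \<in> V \<Longrightarrow> D f = 0 \<Longrightarrow> f \<in> M"
    and "0 \<in> V"
  shows "\<not> lineable s1 (cardSuc (alg_dim s2 K)) (V - M)"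
proof
  interpret D: Vector_Spaces.linear s1 s2 D by fact
  assume "lineable s1 (cardSuc (alg_dim s2 K)) (V - M)"
  then obtain W where W: "vs1.subspace W" "W \<subseteq> (V - M) \<union> {0}"
    and dimW: "alg_dim s1 W =o cardSuc (alg_dim s2 K)"
    unfolding lineable_def by blast
  obtain C where C: "vs1.independent C" "vs1.span C = W"
    using vs1.subspace_has_basis[OF W(1)] .
  have inj: "inj_on D W"
    using W ker by (auto simp: D.inj_on_iff_eq_0)
  have "C \<subseteq> W"
    using C vs1.span_superset by blast
  have indDC: "vs2.independent (D ` C)"
    using D.independent_injective_image C inj by auto
  have "D ` C \<subseteq> K"
    using \<open>C \<subseteq> W\<close> W(2) into \<open>0 \<in> V\<close> by blast
  then obtain B where B: "D ` C \<subseteq> B" "B \<subseteq> K" "vs2.independent B" "K \<subseteq> vs2.span B"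
    using vs2.maximal_independent_subset_extend[OF _ indDC] by metis
  have spanB: "vs2.span B = K"
    using B vs2.span_minimal[OF _ K] by blast
  have "|C| \<le>o |B|"
    using B(1) inj \<open>C \<subseteq> W\<close> by (auto simp: card_of_ordLeq[symmetric] intro: inj_on_subset)
  then have "cardSuc (alg_dim s2 K) \<le>o alg_dim s2 K"
    using vs1.alg_dim_eq_card_basis[OF C] vs2.alg_dim_eq_card_basis[OF B(3) spanB] dimW
    by (meson ordIso_symmetric ordIso_ordLeq_trans ordLeq_ordIso_trans)
  moreover have "Card_order (alg_dim s2 K)"
    unfolding alg_dim_def by (rule card_of_Card_order)
  ultimately show False
    using cardSuc_greater not_ordLess_ordLeq by blast
qed

end

interpretation fun_pair: vector_space_pair
  "pscale :: 'k::field \<Rightarrow> ('a \<Rightarrow> 'k) \<Rightarrow> 'a \<Rightarrow> 'k" "pscale :: 'k \<Rightarrow> ('b \<Rightarrow> 'k) \<Rightarrow> 'b \<Rightarrow> 'k"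
  by (intro vector_space_pair.intro fun_space.vector_space_axioms)


section \<open>Spaces of continuous functions\<close>

lemma linear_pscaleI:
  assumes "\<And>f g. T (f + g) = T f + T g" and "\<And>c f. T (pscale c f) = pscale c (T f)"
  shows "Vector_Spaces.linear pscale pscale T"
  using assms by (simp add: Vector_Spaces.linear_iff fun_space.vector_space_axioms)

lemma subspace_cont_fun:
  "fun_space.subspace (cont_fun X :: ('a \<Rightarrow> 'k::real_normed_field) set)"
proof -
  have "continuous_map X euclidean (\<lambda>x. c * f x)"
    if "continuous_map X euclidean f" for c :: 'k and f
    using that by (simp add: continuous_map_atin tendsto_mult_left)
  then show ?thesis
    by (auto simp: fun_space.subspace_def cont_fun_def pscale_def zero_fun_def plus_fun_def
        intro: continuous_map_add)
qed

lemma linear_res: "Vector_Spaces.linear pscale pscale (res Y)"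
  by (rule linear_pscaleI) (auto simp: res_def pscale_def fun_eq_iff)

lemma subspace_res_ker:
  "fun_space.subspace (res_ker L X Y :: ('a \<Rightarrow> 'k::real_normed_field) set)"
proof -
  have "res_ker L X Y = cont_fun (subtopology L X) \<inter> {f :: 'a \<Rightarrow> 'k. res Y f = 0}"
    by (auto simp: res_ker_def)
  moreover have "fun_space.subspace {f :: 'a \<Rightarrow> 'k. res Y f = 0}"
    using fun_pair.linear_subspace_kernel[OF linear_res] .
  ultimately show ?thesis
    by (simp add: fun_space.subspace_inter subspace_cont_fun)
qed


section \<open>Functions constant on the classes of an equivalence relation\<close>

text \<open>The data of the theorem after composing class map and choice of representative: \<open>X\<close> is
  the closure of the set of points in non-trivial classes, and \<open>r\<close> sends a point to the
  representative of its class.\<close>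

locale class_retraction =
  fixes L :: "'a topology" and \<rho> :: "'a rel" and L' X R' :: "'a set" and r :: "'a \<Rightarrow> 'a"
  assumes X_eq: "X = L closure_of L'"
    and L'_sub: "L' \<subseteq> topspace L"
    and nontrivial: "\<And>x y. (x, y) \<in> \<rho> \<Longrightarrow> x \<noteq> y \<Longrightarrow> x \<in> L'"
    and equiv_rho: "equiv (topspace L) \<rho>"
    and r_cont: "continuous_map (subtopology L X) L r"
    and r_rel: "\<And>x. x \<in> L' \<Longrightarrow> (x, r x) \<in> \<rho>"
    and r_in: "\<And>x. x \<in> L' \<Longrightarrow> r x \<in> R'"
    and r_const: "\<And>x y. (x, y) \<in> \<rho> \<Longrightarrow> r x = r y"
    and r_fix: "\<And>x. x \<in> R' \<Longrightarrow> r x = x"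
    and R'_sub: "R' \<subseteq> X"
begin

lemma X_sub: "X \<subseteq> topspace L"
  unfolding X_eq by (rule closure_of_subset_topspace)

lemma L'_sub_X: "L' \<subseteq> X"
  unfolding X_eq by (rule closure_of_subset[OF L'_sub])

lemma R'_sub_closure: "R' \<subseteq> L closure_of R'"
  using R'_sub X_sub by (intro closure_of_subset) (rule subset_trans)

lemma closure_R'_sub_X: "L closure_of R' \<subseteq> X"
  unfolding X_eq by (rule closure_of_minimal[OF R'_sub[unfolded X_eq] closedin_closure_of])

text \<open>The values of \<open>f\<close> on \<open>L'\<close> are values on \<open>R'\<close>, where \<open>f\<close> vanishes.\<close>

lemma res_eq_0_if_class_constant:
  fixes f :: "'a \<Rightarrow> 'k::real_normed_field"
  assumes "f \<in> cont_fun L" and f: "f \<in> cont_fun_rel L \<rho>"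
    and ker: "res X f \<in> res_ker L X (L closure_of R')"
  shows "res X f = 0"
proof -
  have zero: "f x = 0" if "x \<in> R'" for x
  proof -
    have "res (L closure_of R') (res X f) x = 0"
      using ker by (simp add: res_ker_def)
    then show ?thesis
      using that R'_sub_closure R'_sub by (simp add: res_def subset_iff)
  qed
  have L'0: "f x = 0" if "x \<in> L'" for x
    using f r_rel[OF that] zero[OF r_in[OF that]] by (auto simp: cont_fun_rel_def)
  have "f x = 0" if "x \<in> X" for x
  proof (rule forall_in_closure_of_eq[of x L L' euclidean f "\<lambda>x. 0"])
    show "x \<in> L closure_of L'"
      using that by (simp add: X_eq)
    show "continuous_map L euclidean f"
      using assms(1) by (simp add: cont_fun_def)
  qed (auto simp: L'0)
  then show ?thesis
    by (auto simp: res_def fun_eq_iff)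
qed

text \<open>The hypothesis \<open>ext\<close> is Tietze's theorem for the scalars in question.\<close>

lemma lineable_cont_fun_diff:
  fixes K :: "('a \<Rightarrow> 'k::real_normed_field) set"
  defines "K \<equiv> res_ker L X (L closure_of R')"
  assumes ext: "cont_fun (subtopology L X) \<subseteq> res X ` (cont_fun L :: ('a \<Rightarrow> 'k) set)"
  shows "lineable pscale (alg_dim pscale K) (cont_fun L - cont_fun_rel L \<rho> :: ('a \<Rightarrow> 'k) set)"
proof (rule fun_pair.lineable_if_image_covers[OF linear_res subspace_cont_fun])
  show "fun_space.subspace K"
    unfolding K_def by (rule subspace_res_ker)
  show "K \<subseteq> res X ` cont_fun L"
    using ext by (auto simp: K_def res_ker_def)
qed (unfold K_def, rule res_eq_0_if_class_constant)

text \<open>As \<open>r\<close> fixes \<open>R'\<close> pointwise, \<open>f - f \<circ> r\<close> vanishes on \<open>R'\<close>, hence on its closure by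
  continuity.\<close>

lemma class_deviation_in_res_ker:
  fixes f :: "'a \<Rightarrow> 'k::real_normed_field"
  assumes f: "f \<in> cont_fun L"
  shows "res X (f - (f \<circ> r)) \<in> res_ker L X (L closure_of R')"
proof -
  have cont: "continuous_map (subtopology L X) euclidean (\<lambda>x. f x - f (r x))"
    using f continuous_map_compose[OF r_cont, of euclidean f]
    by (intro continuous_intros) (auto simp: cont_fun_def o_def intro: continuous_map_from_subtopology)
  have "f x - f (r x) = 0" if "x \<in> L closure_of R'" for x
  proof (rule forall_in_closure_of_eq[of x "subtopology L X" R' euclidean _ "\<lambda>x. 0"])
    show "x \<in> subtopology L X closure_of R'"
      using that closure_R'_sub_X R'_sub by (auto simp: closure_of_subtopology inf_absorb2)
  qed (auto simp: r_fix cont)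
  moreover have "res X (f - (f \<circ> r)) \<in> cont_fun (subtopology L X)"
    using X_sub by (auto simp: cont_fun_def res_def intro: continuous_map_eq[OF cont])
  ultimately show ?thesis
    by (auto simp: res_ker_def res_def fun_eq_iff)
qed

text \<open>Only distinct equivalent points need an argument, and these lie in \<open>L'\<close>, where \<open>f\<close> agrees
  with \<open>f \<circ> r\<close> and \<open>r\<close> is constant on classes.\<close>

lemma class_constant_if_deviation_0:
  assumes "f \<in> cont_fun L" and 0: "res X (f - (f \<circ> r)) = 0"
  shows "f \<in> cont_fun_rel L \<rho>"
proof -
  have eq: "f x = f (r x)" if "x \<in> L'" for x
  proof -
    have "res X (f - (f \<circ> r)) x = 0"
      by (simp add: 0)
    then show ?thesis
      using that L'_sub_X by (simp add: res_def subset_iff)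
  qed
  have "f x = f y" if xy: "(x, y) \<in> \<rho>" for x y
  proof (cases "x = y")
    case False
    have "(y, x) \<in> \<rho>"
      using equiv_rho xy by (meson equivE symD)
    then show ?thesis
      using eq[of x] eq[of y] nontrivial xy False r_const by metis
  qed simp
  then show ?thesis
    using assms(1) by (simp add: cont_fun_rel_def)
qed

lemma not_lineable_cont_fun_diff:
  fixes K :: "('a \<Rightarrow> 'k::real_normed_field) set"
  defines "K \<equiv> res_ker L X (L closure_of R')"
  shows "\<not> lineable pscale (cardSuc (alg_dim pscale K)) (cont_fun L - cont_fun_rel L \<rho> :: ('a \<Rightarrow> 'k) set)"
proof (rule fun_pair.not_lineable_cardSuc)
  show "Vector_Spaces.linear pscale pscale (\<lambda>f :: 'a \<Rightarrow> 'k. res X (f - (f \<circ> r)))"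
    by (rule linear_pscaleI) (auto simp: res_def pscale_def fun_eq_iff algebra_simps)
  show "fun_space.subspace K"
    unfolding K_def by (rule subspace_res_ker)
  show "(0 :: 'a \<Rightarrow> 'k) \<in> cont_fun L"
    using subspace_cont_fun by (rule fun_space.subspace_0)
qed (auto simp: K_def class_deviation_in_res_ker intro: class_constant_if_deviation_0)

end


section \<open>Extension of continuous functions from closed sets\<close>

text \<open>The value \<open>0\<close> outside the space is restored after extending.\<close>

lemma cont_fun_subtopology_sub_res_image:
  fixes L :: "'a topology"
  assumes X: "X \<subseteq> topspace L"
    and ext: "\<And>g :: 'a \<Rightarrow> 'k::real_normed_field. continuous_map (subtopology L X) euclidean g \<Longrightarrow>
      \<exists>h. continuous_map L euclidean h \<and> (\<forall>x\<in>X. h x = g x)"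
  shows "cont_fun (subtopology L X) \<subseteq> res X ` (cont_fun L :: ('a \<Rightarrow> 'k) set)"
proof
  fix g :: "'a \<Rightarrow> 'k" assume g: "g \<in> cont_fun (subtopology L X)"
  then obtain h where h: "continuous_map L euclidean h" "\<forall>x\<in>X. h x = g x"
    using ext[of g] by (auto simp: cont_fun_def)
  have "res (topspace L) h \<in> cont_fun L"
    by (auto simp: cont_fun_def res_def intro: continuous_map_eq[OF h(1)])
  moreover have "g = res X (res (topspace L) h)"
    using g h(2) X by (auto simp: cont_fun_def res_def fun_eq_iff)
  ultimately show "g \<in> res X ` cont_fun L"
    by blast
qed

lemma Tietze_real:
  assumes "normal_space L" and "closedin L X" and "continuous_map (subtopology L X) euclideanreal g"
  shows "\<exists>h. continuous_map L euclideanreal h \<and> (\<forall>x\<in>X. h x = g x)"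
  using Tietze_extension_realinterval[OF assms(1,2) is_interval_univ _ assms(3)]
  by (metis UNIV_not_empty subset_UNIV)

lemma Tietze_complex:
  fixes g :: "'a \<Rightarrow> complex"
  assumes "normal_space L" and "closedin L X" and g: "continuous_map (subtopology L X) euclidean g"
  shows "\<exists>h. continuous_map L euclidean h \<and> (\<forall>x\<in>X. h x = g x)"
proof -
  have "continuous_map (subtopology L X) euclideanreal (Re \<circ> g)"
    "continuous_map (subtopology L X) euclideanreal (Im \<circ> g)"
    by (auto intro!: continuous_map_compose[OF g] continuous_intros)
  then obtain u v where
    u: "continuous_map L euclideanreal u" "\<forall>x\<in>X. u x = Re (g x)" and
    v: "continuous_map L euclideanreal v" "\<forall>x\<in>X. v x = Im (g x)"
    using Tietze_real[OF assms(1,2)] by (metis comp_apply)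
  have of_real: "continuous_map euclideanreal (euclidean :: complex topology) of_real"
    and times_i: "continuous_map euclideanreal (euclidean :: complex topology) (\<lambda>t. \<i> * of_real t)"
    by (auto intro!: continuous_intros)
  have "continuous_map L euclidean (\<lambda>x. of_real (u x) + \<i> * of_real (v x))"
    using continuous_map_add[OF continuous_map_compose[OF u(1) of_real]
        continuous_map_compose[OF v(1) times_i]]
    by (simp add: o_def)
  moreover have "\<forall>x\<in>X. of_real (u x) + \<i> * of_real (v x) = g x"
    using u(2) v(2) by (simp add: complex_eq_iff)
  ultimately show ?thesis
    by blast
qed


section \<open>Representatives of equivalence classes\<close>

lemma cone_less_card_of:
  assumes "x \<in> A" and "y \<in> A" and "x \<noteq> y"
  shows "cone <o |A|"
proof -
  have "\<not> |A| \<le>o |{()}|"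
    using assms by (auto simp: card_of_ordLeq[symmetric] inj_on_def)
  then show ?thesis
    unfolding BNF_Cardinal_Arithmetic.cone_def
    by (simp only: not_ordLeq_iff_ordLess[OF card_of_Well_order card_of_Well_order])
qed

lemma rep_map_quot_map:
  assumes "equiv S \<rho>" and "representatives S \<rho> R" and "x \<in> S"
  shows "(x, rep_map R (quot_map \<rho> x)) \<in> \<rho>" and "rep_map R (quot_map \<rho> x) \<in> R"
    and "x \<in> R \<Longrightarrow> rep_map R (quot_map \<rho> x) = x"
proof -
  have ex: "\<exists>!y. y \<in> quot_map \<rho> x \<inter> R"
    using assms(2) quotientI[OF assms(3), of \<rho>] unfolding representatives_def quot_map_def
    by blast
  show "(x, rep_map R (quot_map \<rho> x)) \<in> \<rho>" "rep_map R (quot_map \<rho> x) \<in> R"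
    using theI'[OF ex] by (auto simp: rep_map_def quot_map_def)
  show "rep_map R (quot_map \<rho> x) = x" if "x \<in> R"
    unfolding rep_map_def using ex that equiv_class_self[OF assms(1,3)]
    by (intro the1_equality) (auto simp: quot_map_def)
qed

theorem proposition3p13:
  fixes L :: "'a topology" and \<rho> :: "'a rel" and R L' R' :: "'a set"
    and \<kappa>\<^sub>r :: "('a \<Rightarrow> real) rel" and \<kappa>\<^sub>c :: "('a \<Rightarrow> complex) rel"
  assumes "compact_space L" and "Hausdorff_space L"
    and "equiv (topspace L) \<rho>" and "closedin (prod_topology L L) \<rho>"
    and "L' = {x \<in> topspace L. cone <o |\<rho> `` {x}|}"
    and "representatives (topspace L) \<rho> R"
    and "continuous_map (subtopology L (L closure_of L')) L (rep_map R \<circ> quot_map \<rho>)"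
    and "R' = (L closure_of L') \<inter> R"
    and "\<kappa>\<^sub>r = alg_dim pscale (res_ker L (L closure_of L') (L closure_of R'))"
    and "\<kappa>\<^sub>c = alg_dim pscale (res_ker L (L closure_of L') (L closure_of R'))"
  shows "(lineable pscale \<kappa>\<^sub>r (cont_fun L - cont_fun_rel L \<rho> :: ('a \<Rightarrow> real) set) \<and>
          \<not> lineable pscale (cardSuc \<kappa>\<^sub>r) (cont_fun L - cont_fun_rel L \<rho> :: ('a \<Rightarrow> real) set)) \<and>
         (lineable pscale \<kappa>\<^sub>c (cont_fun L - cont_fun_rel L \<rho> :: ('a \<Rightarrow> complex) set) \<and>
          \<not> lineable pscale (cardSuc \<kappa>\<^sub>c) (cont_fun L - cont_fun_rel L \<rho> :: ('a \<Rightarrow> complex) set))"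
proof -
  let ?X = "L closure_of L'" and ?r = "rep_map R \<circ> quot_map \<rho>"
  note rep = rep_map_quot_map[OF assms(3) assms(6)]
  have L'_sub: "L' \<subseteq> topspace L"
    using assms(5) by blast
  have L'_class: "y \<in> L'" if "x \<in> L'" "(x, y) \<in> \<rho>" for x y
    using that equiv_class_eq[OF assms(3) that(2)] equiv_class_eq_iff[OF assms(3), of x y] assms(5)
    by auto
  interpret class_retraction L \<rho> L' ?X R' ?r
  proof
    show "x \<in> L'" if "(x, y) \<in> \<rho>" "x \<noteq> y" for x y
    proof -
      have "x \<in> topspace L"
        using that(1) assms(3) equiv_class_eq_iff by fastforce
      then show ?thesis
        using cone_less_card_of[of x "\<rho> `` {x}" y] that equiv_class_self[OF assms(3)] assms(5)
        by auto
    qed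
    show "?r x = ?r y" if "(x, y) \<in> \<rho>" for x y
      using equiv_class_eq[OF assms(3) that] by (simp add: quot_map_def)
    show "?r x \<in> R'" if "x \<in> L'" for x
      using rep(1,2)[of x] L'_class[OF that] that L'_sub closure_of_subset[OF L'_sub] assms(8)
      by auto
    show "?r x = x" if "x \<in> R'" for x
      using rep(3)[of x] that assms(8) closure_of_subset_topspace[of L L'] by auto
  qed (use assms L'_sub rep(1) in auto)
  have normal: "normal_space L"
    using assms(1,2) by (simp add: compact_Hausdorff_or_regular_imp_normal_space)
  note ext = cont_fun_subtopology_sub_res_image[OF X_sub]
  show ?thesis
    unfolding assms(9,10)
    by (intro conjI lineable_cont_fun_diff not_lineable_cont_fun_diff ext
        Tietze_real[OF normal] Tietze_complex[OF normal]) auto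
qed

end
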